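(* We have $$\Sigma=C_1^{>}\cup C_1^{<}\cup C_2^{>}\cup C_2^{<}\cup C_3^{>}\cup C_3^{<}\cup\cdots$$ Moreover, for every $k\ge1$, if $(a,b)\in C_k^{>}$ (resp. $(a,b)\in C_k^{<}$), then all nontrivial solutions $u$ of $$Lu=a\,m(t)u^{+}-b\,n(t)u^{-}\ \text{in } ]T_1,T_2[,\qquad u(T_1)=u(T_2)=0$$ with $u'(T_1)>0$ (resp. $u'(T_1)<0$) are multiples of one another.
   Context: Let $T_1<T_2$ be reals and let $p,q,m,n\in C[T_1,T_2]$ be real-valued with $p>0$, $q\ge 0$ on $[T_1,T_2]$, $m\not\equiv 0$, $n\not\equiv 0$. Put $Lu:=-(p(t)u')'+q(t)u$ and $u^{\pm}:=\max\{\pm u,0\}$. For $(a,b)\in\mathbb{R}^2$ consider the problem $$(P)\qquad Lu=a\,m(t)u^{+}-b\,n(t)u^{-}\ \text{in } ]T_1,T_2[,\qquad u(T_1)=u(T_2)=0,$$ solutions being functions $u\in C^1[T_1,T_2]$ with $pu'\in C^1[T_1,T_2]$. The Fučík spectrum $\Sigma$ is the set of $(a,b)\in\mathbb{R}^2$ for which $(P)$ has a nontrivial solution. For $k\ge 1$, $C_k^{>}$ (resp. $C_k^{<}$) is the set of $(a,b)\in\mathbb{R}^2$ such that $(P)$ has a solution $u$ with exactly $k-1$ zeros in $]T_1,T_2[$ and $u'(T_1)>0$ (resp. $u'(T_1)<0$). *)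

theory Defs
  imports "HOL-Analysis.Analysis"
begin

text \<open>
  Functions on the compact interval \<open>[a, b]\<close> are modelled by total functions \<open>real \<Rightarrow> real\<close> of which
  only the values on \<open>{a..b}\<close> matter. Derivatives are therefore taken within \<open>{a..b}\<close>; they are
  one-sided at the endpoints.
\<close>

definition ivl_deriv :: "real \<Rightarrow> real \<Rightarrow> (real \<Rightarrow> real) \<Rightarrow> real \<Rightarrow> real" where
  "ivl_deriv a b u t = vector_derivative u (at t within {a..b})"

definition C1_ivl :: "real \<Rightarrow> real \<Rightarrow> (real \<Rightarrow> real) \<Rightarrow> bool" where
  "C1_ivl a b u \<longleftrightarrow>
     (\<forall>t\<in>{a..b}. u differentiable (at t within {a..b})) \<and> continuous_on {a..b} (ivl_deriv a b u)"

definition SL_op ::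
  "real \<Rightarrow> real \<Rightarrow> (real \<Rightarrow> real) \<Rightarrow> (real \<Rightarrow> real) \<Rightarrow> (real \<Rightarrow> real) \<Rightarrow> real \<Rightarrow> real" where
  "SL_op T1 T2 p q u t =
     - ivl_deriv T1 T2 (\<lambda>s. p s * ivl_deriv T1 T2 u s) t + q t * u t"

definition pos_part :: "(real \<Rightarrow> real) \<Rightarrow> real \<Rightarrow> real" where
  "pos_part u t = max (u t) 0"

definition neg_part :: "(real \<Rightarrow> real) \<Rightarrow> real \<Rightarrow> real" where
  "neg_part u t = max (- u t) 0"

definition fucik_solution ::
  "real \<Rightarrow> real \<Rightarrow> (real \<Rightarrow> real) \<Rightarrow> (real \<Rightarrow> real) \<Rightarrow> (real \<Rightarrow> real) \<Rightarrow> (real \<Rightarrow> real) \<Rightarrow>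
   real \<Rightarrow> real \<Rightarrow> (real \<Rightarrow> real) \<Rightarrow> bool" where
  "fucik_solution T1 T2 p q m n a b u \<longleftrightarrow>
     C1_ivl T1 T2 u \<and>
     C1_ivl T1 T2 (\<lambda>t. p t * ivl_deriv T1 T2 u t) \<and>
     (\<forall>t\<in>{T1<..<T2}. SL_op T1 T2 p q u t = a * m t * pos_part u t - b * n t * neg_part u t) \<and>
     u T1 = 0 \<and> u T2 = 0"

definition nontrivial_on :: "real \<Rightarrow> real \<Rightarrow> (real \<Rightarrow> real) \<Rightarrow> bool" where
  "nontrivial_on T1 T2 u \<longleftrightarrow> (\<exists>t\<in>{T1..T2}. u t \<noteq> 0)"

definition fucik_spectrum ::
  "real \<Rightarrow> real \<Rightarrow> (real \<Rightarrow> real) \<Rightarrow> (real \<Rightarrow> real) \<Rightarrow> (real \<Rightarrow> real) \<Rightarrow> (real \<Rightarrow> real) \<Rightarrow>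
   (real \<times> real) set" where
  "fucik_spectrum T1 T2 p q m n =
     {(a, b). \<exists>u. fucik_solution T1 T2 p q m n a b u \<and> nontrivial_on T1 T2 u}"

text \<open>Finiteness is stated separately because \<^const>\<open>card\<close> is 0 on infinite sets.\<close>

definition has_exactly_zeros :: "real \<Rightarrow> real \<Rightarrow> (real \<Rightarrow> real) \<Rightarrow> nat \<Rightarrow> bool" where
  "has_exactly_zeros T1 T2 u j \<longleftrightarrow>
     finite {t \<in> {T1<..<T2}. u t = 0} \<and> card {t \<in> {T1<..<T2}. u t = 0} = j"

text \<open>The following two sets are meant for \<open>k \<ge> 1\<close> only.\<close>

definition C_gt ::
  "real \<Rightarrow> real \<Rightarrow> (real \<Rightarrow> real) \<Rightarrow> (real \<Rightarrow> real) \<Rightarrow> (real \<Rightarrow> real) \<Rightarrow> (real \<Rightarrow> real) \<Rightarrow>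
   nat \<Rightarrow> (real \<times> real) set" where
  "C_gt T1 T2 p q m n k =
     {(a, b). \<exists>u. fucik_solution T1 T2 p q m n a b u \<and>
        has_exactly_zeros T1 T2 u (k - 1) \<and> ivl_deriv T1 T2 u T1 > 0}"

definition C_lt ::
  "real \<Rightarrow> real \<Rightarrow> (real \<Rightarrow> real) \<Rightarrow> (real \<Rightarrow> real) \<Rightarrow> (real \<Rightarrow> real) \<Rightarrow> (real \<Rightarrow> real) \<Rightarrow>
   nat \<Rightarrow> (real \<times> real) set" where
  "C_lt T1 T2 p q m n k =
     {(a, b). \<exists>u. fucik_solution T1 T2 p q m n a b u \<and>
        has_exactly_zeros T1 T2 u (k - 1) \<and> ivl_deriv T1 T2 u T1 < 0}"

end

theory Submission
  imports Defs
begin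

text \<open>
  Write the equation as a first-order system for \<open>u\<close> and \<open>w = p u'\<close>. Its right-hand side is Lipschitz
  in \<open>(u, w)\<close>, with a constant uniform in \<open>t\<close>, and positively homogeneous. Everything follows from one
  uniqueness principle: if \<open>c \<ge> 0\<close> and \<open>v\<close>, \<open>v'\<close> agree at one point with \<open>c u\<close>, \<open>c u'\<close>, then
  \<open>v = c u\<close> on the whole interval (\<open>fucik_solution_multiple\<close>).

  With \<open>c = 0\<close> it says that a nontrivial solution has only simple zeros. In particular its derivative
  at \<open>T1\<close> does not vanish, and its zeros cannot accumulate, since at an accumulation point the
  derivative would vanish too; by compactness there are finitely many (\<open>fucik_zeros_finite\<close>). Hence
  every nontrivial solution places \<open>(a, b)\<close> in some \<open>C_k\<close>: \<open>k - 1\<close> is its number of interior zeros,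
  and the sign of its initial slope decides between \<open>>\<close> and \<open><\<close>. With
  \<open>c = v'(T1) / u'(T1) > 0\<close> it says that solutions whose initial slopes have the same sign are
  multiples of one another.
\<close>

text \<open>
  A Gronwall argument on the energy \<open>x\<^sup>2 + y\<^sup>2\<close>: its derivative is bounded in modulus by \<open>2 K\<close> times
  the energy itself, so multiplying by \<open>exp (2 K t)\<close> makes it increasing and multiplying by
  \<open>exp (- 2 K t)\<close> makes it decreasing. A zero at \<open>s\<close> thus spreads to the left by the first and to the
  right by the second. Derivatives are taken only in the interior because the differential
  equation is imposed only there.
\<close>

lemma coupled_bounds_imp_zero:
  fixes x y x' y' :: "real \<Rightarrow> real"
  assumes cont: "continuous_on {a..b} x" "continuous_on {a..b} y"
    and derx: "\<And>t. a < t \<Longrightarrow> t < b \<Longrightarrow> (x has_real_derivative x' t) (at t)"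
    and dery: "\<And>t. a < t \<Longrightarrow> t < b \<Longrightarrow> (y has_real_derivative y' t) (at t)"
    and bx: "\<And>t. a < t \<Longrightarrow> t < b \<Longrightarrow> \<bar>x' t\<bar> \<le> K * \<bar>y t\<bar>"
    and by': "\<And>t. a < t \<Longrightarrow> t < b \<Longrightarrow> \<bar>y' t\<bar> \<le> K * \<bar>x t\<bar>"
    and s: "s \<in> {a..b}" "x s = 0" "y s = 0"
    and t: "t \<in> {a..b}"
  shows "x t = 0"
proof -
  define d where "d = (\<lambda>t. (x t)\<^sup>2 + (y t)\<^sup>2)"
  define d' where "d' = (\<lambda>t. 2 * x t * x' t + 2 * y t * y' t)"
  have contd: "continuous_on {a..b} d"
    unfolding d_def by (intro continuous_intros cont)
  have der: "((\<lambda>r. d r * exp (c * r)) has_real_derivative (d' r + c * d r) * exp (c * r)) (at r)"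
    if "a < r" "r < b" for c r
    unfolding d_def d'_def
    by (rule derivative_eq_intros derx dery that refl)+ (simp add: algebra_simps)
  have bd: "\<bar>d' r\<bar> \<le> 2 * K * d r" if r: "a < r" "r < b" for r
  proof -
    have "\<bar>d' r\<bar> \<le> 2 * (\<bar>x r\<bar> * \<bar>x' r\<bar>) + 2 * (\<bar>y r\<bar> * \<bar>y' r\<bar>)"
      unfolding d'_def by (rule order_trans[OF abs_triangle_ineq]) (simp add: abs_mult)
    also have "\<dots> \<le> 2 * (\<bar>x r\<bar> * (K * \<bar>y r\<bar>)) + 2 * (\<bar>y r\<bar> * (K * \<bar>x r\<bar>))"
      by (intro add_mono mult_left_mono bx by' r) auto
    also have "\<dots> = 2 * K * (2 * \<bar>x r\<bar> * \<bar>y r\<bar>)" by simp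
    also have "\<dots> \<le> 2 * K * d r"
      \<comment> \<open>The bounds force \<open>K \<ge> 0\<close> only through a nonzero value of \<open>x\<close> or \<open>y\<close>, whence the case split.\<close>
    proof (cases "x r = 0 \<or> y r = 0")
      case False
      have "0 \<le> K * \<bar>y r\<bar>" using bx[OF r] by (rule order_trans[OF abs_ge_zero])
      then have "0 \<le> K" using False by (simp add: zero_le_mult_iff)
      moreover have "2 * \<bar>x r\<bar> * \<bar>y r\<bar> \<le> d r"
        using sum_squares_bound[of "\<bar>x r\<bar>" "\<bar>y r\<bar>"] by (simp add: d_def)
      ultimately show ?thesis by (intro mult_left_mono) auto
    next
      case True
      have "0 \<le> K * \<bar>y r\<bar>" "0 \<le> K * \<bar>x r\<bar>"
        using bx[OF r] by'[OF r] by (auto intro: order_trans[OF abs_ge_zero])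
      then have "0 \<le> K * \<bar>y r\<bar> * \<bar>y r\<bar> + K * \<bar>x r\<bar> * \<bar>x r\<bar>" by simp
      also have "\<dots> = K * d r" by (simp add: d_def power2_eq_square algebra_simps)
      finally show ?thesis using True by auto
    qed
    finally show ?thesis .
  qed
  have ds: "d s = 0" using s by (simp add: d_def)
  have "d t \<le> 0"
  proof (cases "t \<le> s")
    case True
    have "d t * exp (2 * K * t) \<le> d s * exp (2 * K * s)"
    proof (rule DERIV_nonneg_imp_increasing_open[OF True])
      fix r assume "t < r" "r < s"
      then have r: "a < r" "r < b" using s t by auto
      have growth: "0 \<le> (d' r + 2 * K * d r) * exp (2 * K * r)"
        using bd[OF r] by simp
      show "\<exists>z. ((\<lambda>r. d r * exp (2 * K * r)) has_real_derivative z) (at r) \<and> 0 \<le> z"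
        using der[OF r, of "2 * K"] growth by blast
    next
      show "continuous_on {t..s} (\<lambda>r. d r * exp (2 * K * r))"
        using s t by (intro continuous_intros continuous_on_subset[OF contd]) auto
    qed
    then show ?thesis by (simp add: ds mult_le_0_iff)
  next
    case False
    then have st: "s \<le> t" by simp
    have "d t * exp (- 2 * K * t) \<le> d s * exp (- 2 * K * s)"
    proof (rule DERIV_nonpos_imp_decreasing_open[OF st])
      fix r assume "s < r" "r < t"
      then have r: "a < r" "r < b" using s t by auto
      have decay: "(d' r + - 2 * K * d r) * exp (- 2 * K * r) \<le> 0"
        using bd[OF r] by (simp add: mult_le_0_iff)
      show "\<exists>z. ((\<lambda>r. d r * exp (- 2 * K * r)) has_real_derivative z) (at r) \<and> z \<le> 0"
        using der[OF r, of "- 2 * K"] decay by blast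
    next
      show "continuous_on {s..t} (\<lambda>r. d r * exp (- 2 * K * r))"
        using s t by (intro continuous_intros continuous_on_subset[OF contd]) auto
    qed
    then show ?thesis by (simp add: ds mult_le_0_iff)
  qed
  then show ?thesis
    by (simp add: d_def sum_power2_le_zero_iff)
qed

lemma C1_ivl_has_derivative:
  assumes "C1_ivl a b u" "t \<in> {a..b}"
  shows "(u has_real_derivative ivl_deriv a b u t) (at t within {a..b})"
  using assms vector_derivative_works[of u "at t within {a..b}"]
  by (simp add: C1_ivl_def ivl_deriv_def has_real_derivative_iff_has_vector_derivative)

lemma C1_ivl_has_derivative_interior:
  assumes "C1_ivl a b u" "a < t" "t < b"
  shows "(u has_real_derivative ivl_deriv a b u t) (at t)"
  using C1_ivl_has_derivative[OF assms(1), of t] assms(2,3)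
  by (simp add: at_within_Icc_at)

lemma C1_ivl_continuous:
  assumes "C1_ivl a b u"
  shows "continuous_on {a..b} u"
  by (rule DERIV_continuous_on[OF C1_ivl_has_derivative[OF assms]])

lemma ivl_deriv_eqI:
  assumes "a < b" "t \<in> {a..b}" "(u has_real_derivative D) (at t within {a..b})"
  shows "ivl_deriv a b u t = D"
  unfolding ivl_deriv_def
  using assms by (intro vector_derivative_within_closed_interval)
    (auto simp: has_real_derivative_iff_has_vector_derivative)

text \<open>
  The uniqueness principle. The difference \<open>v - c u\<close> and its flux satisfy the coupled bounds because
  positive homogeneity (this is where \<open>c \<ge> 0\<close> enters) turns \<open>c\<close> times the nonlinearity at \<open>u\<close> into the
  nonlinearity at \<open>c u\<close>, and \<open>u\<^sup>+\<close>, \<open>u\<^sup>-\<close> are 1-Lipschitz in \<open>u\<close>.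
\<close>

lemma fucik_solution_multiple:
  fixes p q m n :: "real \<Rightarrow> real"
  assumes cont: "continuous_on {T1..T2} p" "continuous_on {T1..T2} q"
      "continuous_on {T1..T2} m" "continuous_on {T1..T2} n"
    and pos: "\<forall>t\<in>{T1..T2}. p t > 0"
    and u: "fucik_solution T1 T2 p q m n a b u"
    and v: "fucik_solution T1 T2 p q m n a b v"
    and c: "0 \<le> c"
    and s: "s \<in> {T1..T2}" "v s = c * u s" "ivl_deriv T1 T2 v s = c * ivl_deriv T1 T2 u s"
    and t: "t \<in> {T1..T2}"
  shows "v t = c * u t"
proof -
  define fl where "fl = (\<lambda>u t. p t * ivl_deriv T1 T2 u t)"
  \<comment> \<open>\<open>1 / p\<close> is the rate in \<open>u' = w / p\<close>; the other terms are a Lipschitz constant of \<open>w'\<close> in \<open>u\<close>.\<close>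
  define g where "g = (\<lambda>r. 1 / p r + \<bar>q r\<bar> + \<bar>a * m r\<bar> + \<bar>b * n r\<bar>)"
  have C1: "C1_ivl T1 T2 u" "C1_ivl T1 T2 v" "C1_ivl T1 T2 (fl u)" "C1_ivl T1 T2 (fl v)"
    using u v by (simp_all add: fucik_solution_def fl_def)
  have "continuous_on {T1..T2} g"
    unfolding g_def using pos by (intro continuous_intros cont) force
  then have "bounded (g ` {T1..T2})"
    by (intro compact_imp_bounded compact_continuous_image compact_Icc)
  then obtain K where "\<forall>z\<in>g ` {T1..T2}. \<bar>z\<bar> \<le> K"
    unfolding bounded_real by blast
  then have K: "g r \<le> K" if "r \<in> {T1..T2}" for r using that by (force simp: abs_le_iff)
  have flux: "ivl_deriv T1 T2 (fl w) r
      = q r * w r - a * m r * max (w r) 0 + b * n r * max (- w r) 0"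
    if "fucik_solution T1 T2 p q m n a b w" "T1 < r" "r < T2" for w r
  proof -
    have "SL_op T1 T2 p q w r = a * m r * pos_part w r - b * n r * neg_part w r"
      using that by (simp add: fucik_solution_def)
    then show ?thesis by (simp add: SL_op_def fl_def pos_part_def neg_part_def)
  qed
  have "(\<lambda>r. v r - c * u r) t = 0"
  proof (rule coupled_bounds_imp_zero[where a=T1 and b=T2 and K=K and s=s
        and x="\<lambda>r. v r - c * u r" and y="\<lambda>r. fl v r - c * fl u r"
        and x'="\<lambda>r. ivl_deriv T1 T2 v r - c * ivl_deriv T1 T2 u r"
        and y'="\<lambda>r. ivl_deriv T1 T2 (fl v) r - c * ivl_deriv T1 T2 (fl u) r"])
    show "continuous_on {T1..T2} (\<lambda>r. v r - c * u r)"
      "continuous_on {T1..T2} (\<lambda>r. fl v r - c * fl u r)"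
      by (intro continuous_intros C1_ivl_continuous C1)+
    show "s \<in> {T1..T2}" "t \<in> {T1..T2}" "v s - c * u s = 0" "fl v s - c * fl u s = 0"
      using s t by (simp_all add: fl_def)
  next
    fix r assume r: "T1 < r" "r < T2"
    show "((\<lambda>r. v r - c * u r) has_real_derivative
        ivl_deriv T1 T2 v r - c * ivl_deriv T1 T2 u r) (at r)"
      "((\<lambda>r. fl v r - c * fl u r) has_real_derivative
        ivl_deriv T1 T2 (fl v) r - c * ivl_deriv T1 T2 (fl u) r) (at r)"
      by (intro DERIV_diff DERIV_cmult C1_ivl_has_derivative_interior C1 r)+
    have p: "p r > 0" using pos r by auto
    have gK: "g r \<le> K" using K r by simp
    have "1 / p r \<le> K" using gK by (simp add: g_def)
    moreover have "\<bar>ivl_deriv T1 T2 v r - c * ivl_deriv T1 T2 u r\<bar>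
        = 1 / p r * \<bar>fl v r - c * fl u r\<bar>"
    proof -
      have "fl v r - c * fl u r = p r * (ivl_deriv T1 T2 v r - c * ivl_deriv T1 T2 u r)"
        by (simp add: fl_def algebra_simps)
      then show ?thesis using p by (simp add: abs_mult)
    qed
    ultimately show "\<bar>ivl_deriv T1 T2 v r - c * ivl_deriv T1 T2 u r\<bar> \<le> K * \<bar>fl v r - c * fl u r\<bar>"
      by (simp only: mult_right_mono abs_ge_zero)
    have hom: "c * max (u r) 0 = max (c * u r) 0" "c * max (- u r) 0 = max (- (c * u r)) 0"
      using c by (simp_all add: max_mult_distrib_left)
    let ?x = "v r - c * u r"
    define P where "P = max (v r) 0 - max (c * u r) 0"
    define N where "N = max (- v r) 0 - max (- (c * u r)) 0"
    have PN: "\<bar>P\<bar> \<le> \<bar>?x\<bar>" "\<bar>N\<bar> \<le> \<bar>?x\<bar>" unfolding P_def N_def by linarith+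
    have "ivl_deriv T1 T2 (fl v) r - c * ivl_deriv T1 T2 (fl u) r
        = q r * ?x - a * m r * P + b * n r * N"
      unfolding P_def N_def hom[symmetric] flux[OF u r] flux[OF v r] by (simp add: algebra_simps)
    also have "\<bar>\<dots>\<bar> \<le> \<bar>q r\<bar> * \<bar>?x\<bar> + \<bar>a * m r\<bar> * \<bar>P\<bar> + \<bar>b * n r\<bar> * \<bar>N\<bar>"
      by (simp only: abs_mult[symmetric])
    also have "\<dots> \<le> \<bar>q r\<bar> * \<bar>?x\<bar> + \<bar>a * m r\<bar> * \<bar>?x\<bar> + \<bar>b * n r\<bar> * \<bar>?x\<bar>"
      by (intro add_mono mult_left_mono PN) auto
    also have "\<dots> = (g r - 1 / p r) * \<bar>?x\<bar>" by (simp add: g_def algebra_simps)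
    also have "\<dots> \<le> K * \<bar>?x\<bar>"
    proof (rule mult_right_mono)
      have "0 < 1 / p r" using p by simp
      then show "g r - 1 / p r \<le> K" using gK by linarith
    qed simp
    finally show "\<bar>ivl_deriv T1 T2 (fl v) r - c * ivl_deriv T1 T2 (fl u) r\<bar> \<le> K * \<bar>?x\<bar>" .
  qed
  then show ?thesis by simp
qed

text \<open>
  The difference quotients along the zeros vanish. Being stated for derivatives within a set, this
  also covers zeros that accumulate at an endpoint.
\<close>

lemma derivative_zero_at_limit_of_zeros:
  fixes u :: "real \<Rightarrow> real"
  assumes der: "(u has_real_derivative D) (at z within S)"
    and lim: "z islimpt {t \<in> S. u t = 0}" and z: "u z = 0"
  shows "D = 0"
proof -
  let ?Z = "{t \<in> S. u t = 0}"
  have "(u has_real_derivative D) (at z within ?Z)"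
    using der by (rule DERIV_subset) auto
  then have D: "((\<lambda>t. (u t - u z) / (t - z)) \<longlongrightarrow> D) (at z within ?Z)"
    by (simp add: has_field_derivative_iff)
  have "((\<lambda>t. (u t - u z) / (t - z)) \<longlongrightarrow> 0) (at z within ?Z)"
    by (rule Lim_transform_within[OF tendsto_const zero_less_one]) (simp add: z)
  moreover have "at z within ?Z \<noteq> bot"
    using lim by (simp add: trivial_limit_within)
  ultimately show ?thesis using tendsto_unique D by blast
qed

text \<open>
  Infinitely many zeros accumulate at some zero by compactness; it is a double zero, so that the
  uniqueness principle with \<open>c = 0\<close> makes the solution vanish identically.
\<close>

lemma fucik_zeros_finite:
  fixes p q m n :: "real \<Rightarrow> real"
  assumes cont: "continuous_on {T1..T2} p" "continuous_on {T1..T2} q"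
      "continuous_on {T1..T2} m" "continuous_on {T1..T2} n"
    and pos: "\<forall>t\<in>{T1..T2}. p t > 0"
    and u: "fucik_solution T1 T2 p q m n a b u" and nt: "nontrivial_on T1 T2 u"
  shows "finite {t \<in> {T1..T2}. u t = 0}"
proof (rule ccontr)
  let ?Z = "{t \<in> {T1..T2}. u t = 0}"
  assume "infinite ?Z"
  have C1: "C1_ivl T1 T2 u" using u by (simp add: fucik_solution_def)
  have "closed ?Z"
    using continuous_closed_preimage_constant[OF C1_ivl_continuous[OF C1] closed_atLeastAtMost] .
  moreover have "bounded ?Z" by (rule bounded_subset[OF bounded_closed_interval[of T1 T2]]) auto
  ultimately have "compact ?Z" by (simp add: compact_eq_bounded_closed)
  then obtain z where z: "z \<in> ?Z" "z islimpt ?Z"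
    using Heine_Borel_imp_Bolzano_Weierstrass[OF _ \<open>infinite ?Z\<close> subset_refl] by blast
  have "ivl_deriv T1 T2 u z = 0"
    using derivative_zero_at_limit_of_zeros[OF C1_ivl_has_derivative[OF C1]] z by blast
  then have "u t = 0 * u t" if "t \<in> {T1..T2}" for t
    using z that by - (rule fucik_solution_multiple[OF cont pos u u, of 0 z], auto)
  then show False using nt by (auto simp: nontrivial_on_def)
qed

theorem proposition3p1:
  fixes T1 T2 :: real and p q m n :: "real \<Rightarrow> real"
  assumes "T1 < T2"
    and "continuous_on {T1..T2} p" and "continuous_on {T1..T2} q"
    and "continuous_on {T1..T2} m" and "continuous_on {T1..T2} n"
    and "\<forall>t\<in>{T1..T2}. p t > 0" and "\<forall>t\<in>{T1..T2}. q t \<ge> 0"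
    and "\<exists>t\<in>{T1..T2}. m t \<noteq> 0" and "\<exists>t\<in>{T1..T2}. n t \<noteq> 0"
  shows "fucik_spectrum T1 T2 p q m n =
           (\<Union>k\<in>{1..}. C_gt T1 T2 p q m n k \<union> C_lt T1 T2 p q m n k) \<and>
         (\<forall>k\<ge>1. \<forall>a b.
           ((a, b) \<in> C_gt T1 T2 p q m n k \<longrightarrow>
             (\<forall>u v. fucik_solution T1 T2 p q m n a b u \<and> nontrivial_on T1 T2 u \<and>
                      ivl_deriv T1 T2 u T1 > 0 \<and>
                    fucik_solution T1 T2 p q m n a b v \<and> nontrivial_on T1 T2 v \<and>
                      ivl_deriv T1 T2 v T1 > 0 \<longrightarrow>
                    (\<exists>c::real. \<forall>t\<in>{T1..T2}. v t = c * u t))) \<and>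
           ((a, b) \<in> C_lt T1 T2 p q m n k \<longrightarrow>
             (\<forall>u v. fucik_solution T1 T2 p q m n a b u \<and> nontrivial_on T1 T2 u \<and>
                      ivl_deriv T1 T2 u T1 < 0 \<and>
                    fucik_solution T1 T2 p q m n a b v \<and> nontrivial_on T1 T2 v \<and>
                      ivl_deriv T1 T2 v T1 < 0 \<longrightarrow>
                    (\<exists>c::real. \<forall>t\<in>{T1..T2}. v t = c * u t))))"
proof -
  note T = assms(1)
  note unique = fucik_solution_multiple[OF assms(2-6)]
  have T1: "T1 \<in> {T1..T2}" using T by simp
  have slope: "ivl_deriv T1 T2 u T1 \<noteq> 0"
    if u: "fucik_solution T1 T2 p q m n a b u" and nt: "nontrivial_on T1 T2 u" for a b u
  proof
    assume "ivl_deriv T1 T2 u T1 = 0"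
    then have "u t = 0 * u t" if "t \<in> {T1..T2}" for t
      using u that T1 by - (rule unique[OF u u, of 0 T1], auto simp: fucik_solution_def)
    then show False using nt by (auto simp: nontrivial_on_def)
  qed
  have nontrivial: "nontrivial_on T1 T2 u" if "ivl_deriv T1 T2 u T1 \<noteq> 0" for u
  proof (rule ccontr)
    assume "\<not> nontrivial_on T1 T2 u"
    then have zero: "u t = 0" if "t \<in> {T1..T2}" for t
      using that by (simp add: nontrivial_on_def)
    have "(u has_real_derivative 0) (at T1 within {T1..T2})"
      by (rule has_field_derivative_transform_within[OF DERIV_const[of 0] zero_less_one T1])
        (simp add: zero)
    then show False using that ivl_deriv_eqI[OF T T1] by blast
  qed
  have spectrum: "fucik_spectrum T1 T2 p q m n =
      (\<Union>k\<in>{1..}. C_gt T1 T2 p q m n k \<union> C_lt T1 T2 p q m n k)" (is "_ = ?R")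
  proof (intro equalityI subsetI; clarify)
    fix a b assume "(a, b) \<in> fucik_spectrum T1 T2 p q m n"
    then obtain u where u: "fucik_solution T1 T2 p q m n a b u" and nt: "nontrivial_on T1 T2 u"
      by (auto simp: fucik_spectrum_def)
    define k where "k = Suc (card {t \<in> {T1<..<T2}. u t = 0})"
    have "finite {t \<in> {T1<..<T2}. u t = 0}"
      by (rule finite_subset[OF _ fucik_zeros_finite[OF assms(2-6) u nt]]) auto
    then have "has_exactly_zeros T1 T2 u (k - 1)" by (simp add: has_exactly_zeros_def k_def)
    then have "(a, b) \<in> C_gt T1 T2 p q m n k \<union> C_lt T1 T2 p q m n k"
      using u slope[OF u nt] unfolding C_gt_def C_lt_def by force
    moreover have "k \<in> {1..}" by (simp add: k_def)
    ultimately show "(a, b) \<in> ?R" by blast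
  next
    fix a b k assume "(a, b) \<in> C_gt T1 T2 p q m n k \<union> C_lt T1 T2 p q m n k"
    then obtain u where u: "fucik_solution T1 T2 p q m n a b u" "ivl_deriv T1 T2 u T1 \<noteq> 0"
      by (auto simp: C_gt_def C_lt_def)
    then show "(a, b) \<in> fucik_spectrum T1 T2 p q m n"
      using nontrivial by (auto simp: fucik_spectrum_def)
  qed
  have multiple: "\<exists>c. \<forall>t\<in>{T1..T2}. v t = c * u t"
    if u: "fucik_solution T1 T2 p q m n a b u" and v: "fucik_solution T1 T2 p q m n a b v"
      and sg: "ivl_deriv T1 T2 u T1 > 0 \<and> ivl_deriv T1 T2 v T1 > 0 \<or>
        ivl_deriv T1 T2 u T1 < 0 \<and> ivl_deriv T1 T2 v T1 < 0" for a b u v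
  proof (intro exI ballI)
    have "ivl_deriv T1 T2 v T1 / ivl_deriv T1 T2 u T1 > 0"
      using sg by (auto intro: divide_pos_pos divide_neg_neg)
    moreover fix t assume "t \<in> {T1..T2}"
    ultimately show "v t = ivl_deriv T1 T2 v T1 / ivl_deriv T1 T2 u T1 * u t"
      using u v sg T1 by - (rule unique[OF u v, of _ T1], auto simp: fucik_solution_def)
  qed
  show ?thesis
    by (intro conjI allI impI) (use spectrum multiple in blast)+
qed

end
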